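(* Let $\Gamma$, $V$, $T$, $\Upsilon$, $\Psi$, $q$, $e$ be as in the context, and let $\pi_1,\pi_2:U_q(\mathfrak{sl}_2)\to\mathrm{End}(V)$ be the representations given by the first and second module structures described in the context. Then $$\pi_2(z)=\pi_1(z),$$ $$\pi_2(x)=-q^{2e}\Upsilon^{-2}\Psi^2\pi_1(x)+(I+q^{2e}\Upsilon^{-2}\Psi^2)\pi_1(z)^{-1},$$ $$\pi_2(y)=-q^{-2e}\Upsilon^{2}\Psi^{-2}\pi_1(y)+(I+q^{-2e}\Upsilon^{2}\Psi^{-2})\pi_1(z)^{-1}.$$
   Context: Let $b$ be a prime power, $D\ge3$, and $U$ a finite-dimensional $\mathbb{F}_b$-space with one of the nondegenerate forms: symplectic, $\dim U=2D$ ($e=1$); quadratic, $\dim U=2D+1$ ($e=1$); quadratic of Witt index $D$, $\dim U=2D$ ($e=0$); quadratic of Witt index $D$, $\dim U=2D+2$ ($e=2$); Hermitean, $\dim U=2D+1$, $b$ a square ($e=3/2$); Hermitean, $\dim U=2D$, $b$ a square ($e=1/2$). The dual polar graph $\Gamma$: vertices $X$ = maximal isotropic subspaces, $y\sim z$ iff $\dim(y\cap z)=D-1$, $\partial(y,z)=D-\dim(y\cap z)$. Let $q=\sqrt b>0$. $V=\mathbb{C}^X$, $A$ adjacency matrix, $\theta_0>\dots>\theta_D$ its eigenvalues, $E_i$ orthogonal projection onto the $\theta_i$-eigenspace; fix $x\in X$, $E^*_i$ diagonal with $(y,y)$-entry $1$ if $\partial(x,y)=i$ else $0$, $A^*$ diagonal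 with $(y,y)$-entry $|X|(E_1)_{xy}$, $T$ generated by $A,A^*$. For irreducible $T$-module $W$: $r=\min\{i:E^*_iW\ne0\}$, $t=\min\{i:E_iW\ne0\}$, $d=|\{i:E^*_iW\ne0\}|-1$. $\Upsilon$ (resp. $\Psi$) is the central element of $T$ acting on the span of the irreducible $T$-modules with $r+t+d-D=\mu$ (resp. $r-t=\nu$) as $q^\mu I$ (resp. $q^\nu I$). $U_q(\mathfrak{sl}_2)$ has generators $x,y,z^{\pm1}$ with relations $zz^{-1}=z^{-1}z=1$, $\frac{qxy-q^{-1}yx}{q-q^{-1}}=\frac{qyz-q^{-1}zy}{q-q^{-1}}=\frac{qzx-q^{-1}xz}{q-q^{-1}}=1$. Put $h=\frac{1-q^{2e}}{q^2-1}$, $h^*=-\frac{b(b^{D+e-2}+1)}{b-1}$, $\kappa=\frac{q^{2e+D}}{q^2-1}$, $\kappa^*=\xi q^{-D}$ with $\xi=\frac{b^2(b^{D+e-2}+1)(b^{D+e-1}+1)}{(b-1)(b^e+b)}$, $\upsilon=-\frac{q^D}{q^2-1}$. The first module structure is the unique one with $A=h1+\kappa\Upsilon^{-1}\Psi x+\upsilon\Upsilon\Psi^{-1}y$, $A^*=h^*1+\kappa^*\Upsilon^{-1}\Psi^{-1}z$; the second is the unique one with $A=h1+\kappa\Upsilon^{-1}\Psi y+\upsilon\Upsilon\Psi^{-1}x$, $A^*=h^*1+\kappa^*\Upsilon^{-1}\Psi^{-1}z$. *)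

theory Defs
  imports
    Complex_Main
    "HOL-Library.Poly_Mapping"
    "HOL-Library.Function_Algebras"
    "HOL-Algebra.QuotRing"
    "HOL-Algebra.Module"
begin

section \<open>Formed spaces over a finite field\<close>

datatype ('k, 'u) polar_form =
    Symplectic "'u \<Rightarrow> 'u \<Rightarrow> 'k"
  | Quadratic "'u \<Rightarrow> 'k"
  | Hermitean "'u \<Rightarrow> 'u \<Rightarrow> 'k"

definition bilinear_form :: "('k::field \<Rightarrow> 'u::ab_group_add \<Rightarrow> 'u) \<Rightarrow> ('u \<Rightarrow> 'u \<Rightarrow> 'k) \<Rightarrow> bool" where
  "bilinear_form scale B \<longleftrightarrow>
     (\<forall>v. Vector_Spaces.linear scale (*) (\<lambda>u. B u v)) \<and>
     (\<forall>u. Vector_Spaces.linear scale (*) (\<lambda>v. B u v))"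

definition nondegenerate_symplectic ::
    "('k::field \<Rightarrow> 'u::ab_group_add \<Rightarrow> 'u) \<Rightarrow> ('u \<Rightarrow> 'u \<Rightarrow> 'k) \<Rightarrow> bool" where
  "nondegenerate_symplectic scale B \<longleftrightarrow>
     bilinear_form scale B \<and> (\<forall>u. B u u = 0) \<and> (\<forall>u. (\<forall>v. B u v = 0) \<longrightarrow> u = 0)"

definition polarization :: "('u::ab_group_add \<Rightarrow> 'k::field) \<Rightarrow> 'u \<Rightarrow> 'u \<Rightarrow> 'k" where
  "polarization Q u v = Q (u + v) - Q u - Q v"

text \<open>
  Nondegeneracy of a quadratic form means that the radical of its polarization contains no
  nonzero singular vector. In odd characteristic this says that the polarization is
  nondegenerate; in characteristic 2 and odd dimension the polarization always has a
  one-dimensional radical, and this is the standard notion.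
\<close>

definition nondegenerate_quadratic ::
    "('k::field \<Rightarrow> 'u::ab_group_add \<Rightarrow> 'u) \<Rightarrow> ('u \<Rightarrow> 'k) \<Rightarrow> bool" where
  "nondegenerate_quadratic scale Q \<longleftrightarrow>
     (\<forall>c u. Q (scale c u) = c\<^sup>2 * Q u) \<and> bilinear_form scale (polarization Q) \<and>
     (\<forall>u. Q u = 0 \<and> (\<forall>v. polarization Q u v = 0) \<longrightarrow> u = 0)"

text \<open>
  If the field has \<open>s * s\<close> elements, its involutory automorphism is \<open>a \<mapsto> a ^ s\<close>.
\<close>

definition nondegenerate_hermitean ::
    "('k::{field,finite} \<Rightarrow> 'u::ab_group_add \<Rightarrow> 'u) \<Rightarrow> ('u \<Rightarrow> 'u \<Rightarrow> 'k) \<Rightarrow> bool" where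
  "nondegenerate_hermitean scale H \<longleftrightarrow>
     (\<exists>s. s * s = card (UNIV :: 'k set) \<and>
        (\<forall>v. Vector_Spaces.linear scale (*) (\<lambda>u. H u v)) \<and>
        (\<forall>u v. H v u = H u v ^ s)) \<and>
     (\<forall>u. (\<forall>v. H u v = 0) \<longrightarrow> u = 0)"

fun vanishes_on :: "('k::field, 'u) polar_form \<Rightarrow> 'u set \<Rightarrow> bool" where
  "vanishes_on (Symplectic B) W \<longleftrightarrow> (\<forall>u\<in>W. \<forall>v\<in>W. B u v = 0)"
| "vanishes_on (Quadratic Q) W \<longleftrightarrow> (\<forall>u\<in>W. Q u = 0)"
| "vanishes_on (Hermitean H) W \<longleftrightarrow> (\<forall>u\<in>W. \<forall>v\<in>W. H u v = 0)"

definition isotropic_subspace ::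
    "('k::field \<Rightarrow> 'u::ab_group_add \<Rightarrow> 'u) \<Rightarrow> ('k, 'u) polar_form \<Rightarrow> 'u set \<Rightarrow> bool" where
  "isotropic_subspace scale F W \<longleftrightarrow> module.subspace scale W \<and> vanishes_on F W"

definition witt_index ::
    "('k::field \<Rightarrow> 'u::ab_group_add \<Rightarrow> 'u) \<Rightarrow> ('k, 'u) polar_form \<Rightarrow> nat" where
  "witt_index scale F = Max (vector_space.dim scale ` {W. isotropic_subspace scale F W})"

definition polar_space ::
    "('k::{field,finite} \<Rightarrow> 'u::ab_group_add \<Rightarrow> 'u) \<Rightarrow> ('k, 'u) polar_form \<Rightarrow> nat \<Rightarrow> real \<Rightarrow> bool" where
  "polar_space scale F D e \<longleftrightarrow>
     vector_space scale \<and> (\<exists>B. finite B \<and> module.span scale B = UNIV) \<and>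
     (let n = vector_space.dim scale UNIV in
      case F of
        Symplectic B \<Rightarrow> nondegenerate_symplectic scale B \<and> n = 2 * D \<and> e = 1
      | Quadratic Q \<Rightarrow> nondegenerate_quadratic scale Q \<and>
          (n = 2 * D + 1 \<and> e = 1 \<or>
           n = 2 * D \<and> witt_index scale F = D \<and> e = 0 \<or>
           n = 2 * D + 2 \<and> witt_index scale F = D \<and> e = 2)
      | Hermitean H \<Rightarrow> nondegenerate_hermitean scale H \<and>
          (n = 2 * D + 1 \<and> e = 3 / 2 \<or> n = 2 * D \<and> e = 1 / 2))"


section \<open>Complex vectors and matrices indexed by a finite set\<close>

text \<open>
  Vectors and matrices indexed by \<open>X\<close> are functions on the ambient type that vanish off \<open>X\<close>.
\<close>

type_synonym 'a cvec = "'a \<Rightarrow> complex"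
type_synonym 'a cmat = "'a \<Rightarrow> 'a \<Rightarrow> complex"

definition vecs :: "'a set \<Rightarrow> 'a cvec set" where
  "vecs X = {v. \<forall>y. y \<notin> X \<longrightarrow> v y = 0}"

definition cscale :: "complex \<Rightarrow> 'a cvec \<Rightarrow> 'a cvec" where
  "cscale c v = (\<lambda>y. c * v y)"

definition mat_alg :: "'a set \<Rightarrow> (complex, 'a cmat) module" where
  "mat_alg X =
    \<lparr> carrier = {M. \<forall>y z. y \<notin> X \<or> z \<notin> X \<longrightarrow> M y z = 0},
      mult = (\<lambda>M N y z. \<Sum>w\<in>X. M y w * N w z),
      one = (\<lambda>y z. if y \<in> X \<and> y = z then 1 else 0),
      zero = (\<lambda>y z. 0),
      add = (\<lambda>M N y z. M y z + N y z),
      smult = (\<lambda>c M y z. c * M y z) \<rparr>"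

definition mat_vec :: "'a set \<Rightarrow> 'a cmat \<Rightarrow> 'a cvec \<Rightarrow> 'a cvec" where
  "mat_vec X M v = (\<lambda>y. \<Sum>z\<in>X. M y z * v z)"

definition diag :: "'a set \<Rightarrow> 'a cvec \<Rightarrow> 'a cmat" where
  "diag X f = (\<lambda>y z. if y \<in> X \<and> y = z then f y else 0)"

definition herm_inner :: "'a set \<Rightarrow> 'a cvec \<Rightarrow> 'a cvec \<Rightarrow> complex" where
  "herm_inner X u v = (\<Sum>y\<in>X. u y * cnj (v y))"

definition orth_proj :: "'a set \<Rightarrow> 'a cvec set \<Rightarrow> 'a cmat" where
  "orth_proj X W = (THE P. P \<in> carrier (mat_alg X) \<and>
     (\<forall>v\<in>vecs X. mat_vec X P v \<in> W \<and> (\<forall>w\<in>W. herm_inner X (v - mat_vec X P v) w = 0)))"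

inductive_set generated_algebra :: "'a set \<Rightarrow> 'a cmat set \<Rightarrow> 'a cmat set"
  for X :: "'a set" and G :: "'a cmat set" where
  gen: "M \<in> G \<Longrightarrow> M \<in> generated_algebra X G"
| one: "\<one>\<^bsub>mat_alg X\<^esub> \<in> generated_algebra X G"
| smult: "M \<in> generated_algebra X G \<Longrightarrow> c \<odot>\<^bsub>mat_alg X\<^esub> M \<in> generated_algebra X G"
| add: "M \<in> generated_algebra X G \<Longrightarrow> N \<in> generated_algebra X G
    \<Longrightarrow> M \<oplus>\<^bsub>mat_alg X\<^esub> N \<in> generated_algebra X G"
| mult: "M \<in> generated_algebra X G \<Longrightarrow> N \<in> generated_algebra X G
    \<Longrightarrow> M \<otimes>\<^bsub>mat_alg X\<^esub> N \<in> generated_algebra X G"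


section \<open>Dual polar graphs and their Terwilliger algebra\<close>

definition dp_vertices ::
    "('k::field \<Rightarrow> 'u::ab_group_add \<Rightarrow> 'u) \<Rightarrow> ('k, 'u) polar_form \<Rightarrow> 'u set set" where
  "dp_vertices scale F = {y. isotropic_subspace scale F y \<and>
     (\<forall>W. isotropic_subspace scale F W \<and> y \<subseteq> W \<longrightarrow> W = y)}"

definition dp_dist :: "('k::field \<Rightarrow> 'u::ab_group_add \<Rightarrow> 'u) \<Rightarrow> nat \<Rightarrow> 'u set \<Rightarrow> 'u set \<Rightarrow> nat" where
  "dp_dist scale D y z = D - vector_space.dim scale (y \<inter> z)"

definition dp_adjacency ::
    "('k::field \<Rightarrow> 'u::ab_group_add \<Rightarrow> 'u) \<Rightarrow> ('k, 'u) polar_form \<Rightarrow> nat \<Rightarrow> 'u set cmat" where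
  "dp_adjacency scale F D = (\<lambda>y z.
     if y \<in> dp_vertices scale F \<and> z \<in> dp_vertices scale F \<and>
        vector_space.dim scale (y \<inter> z) = D - 1
     then 1 else 0)"

definition eigenspace :: "'a set \<Rightarrow> 'a cmat \<Rightarrow> real \<Rightarrow> 'a cvec set" where
  "eigenspace X A \<theta> = {v \<in> vecs X. mat_vec X A v = cscale (of_real \<theta>) v}"

text \<open>\<open>theta X A i\<close> is the \<open>i\<close>-th largest eigenvalue (counted from 0) of the symmetric
  real matrix \<open>A\<close>.\<close>

definition theta :: "'a set \<Rightarrow> 'a cmat \<Rightarrow> nat \<Rightarrow> real" where
  "theta X A i = rev (sorted_list_of_set {\<theta>. eigenspace X A \<theta> \<noteq> {0}}) ! i"

definition prim_idem :: "'a set \<Rightarrow> 'a cmat \<Rightarrow> nat \<Rightarrow> 'a cmat" where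
  "prim_idem X A i = orth_proj X (eigenspace X A (theta X A i))"

definition dual_idem :: "'a set \<Rightarrow> ('a \<Rightarrow> 'a \<Rightarrow> nat) \<Rightarrow> 'a \<Rightarrow> nat \<Rightarrow> 'a cmat" where
  "dual_idem X dst x i = diag X (\<lambda>y. if dst x y = i then 1 else 0)"

definition dual_adjacency :: "'a set \<Rightarrow> 'a cmat \<Rightarrow> 'a \<Rightarrow> 'a cmat" where
  "dual_adjacency X A x = diag X (\<lambda>y. of_nat (card X) * prim_idem X A 1 x y)"

definition terwilliger_algebra :: "'a set \<Rightarrow> 'a cmat \<Rightarrow> 'a \<Rightarrow> 'a cmat set" where
  "terwilliger_algebra X A x = generated_algebra X {A, dual_adjacency X A x}"

definition T_module :: "'a set \<Rightarrow> 'a cmat set \<Rightarrow> 'a cvec set \<Rightarrow> bool" where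
  "T_module X T W \<longleftrightarrow> W \<subseteq> vecs X \<and> module.subspace cscale W \<and>
     (\<forall>M\<in>T. \<forall>w\<in>W. mat_vec X M w \<in> W)"

definition irreducible_T_module :: "'a set \<Rightarrow> 'a cmat set \<Rightarrow> 'a cvec set \<Rightarrow> bool" where
  "irreducible_T_module X T W \<longleftrightarrow> T_module X T W \<and> W \<noteq> {0} \<and>
     (\<forall>W'. T_module X T W' \<and> W' \<subseteq> W \<longrightarrow> W' = {0} \<or> W' = W)"

definition endpoint ::
    "'a set \<Rightarrow> ('a \<Rightarrow> 'a \<Rightarrow> nat) \<Rightarrow> nat \<Rightarrow> 'a \<Rightarrow> 'a cvec set \<Rightarrow> nat" where
  "endpoint X dst D x W = (LEAST i. i \<le> D \<and> mat_vec X (dual_idem X dst x i) ` W \<noteq> {0})"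

definition dual_endpoint :: "'a set \<Rightarrow> 'a cmat \<Rightarrow> nat \<Rightarrow> 'a cvec set \<Rightarrow> nat" where
  "dual_endpoint X A D W = (LEAST i. i \<le> D \<and> mat_vec X (prim_idem X A i) ` W \<noteq> {0})"

definition module_diameter ::
    "'a set \<Rightarrow> ('a \<Rightarrow> 'a \<Rightarrow> nat) \<Rightarrow> nat \<Rightarrow> 'a \<Rightarrow> 'a cvec set \<Rightarrow> nat" where
  "module_diameter X dst D x W = card {i. i \<le> D \<and> mat_vec X (dual_idem X dst x i) ` W \<noteq> {0}} - 1"

definition central_acting ::
    "'a set \<Rightarrow> 'a cmat set \<Rightarrow> real \<Rightarrow> ('a cvec set \<Rightarrow> int) \<Rightarrow> 'a cmat \<Rightarrow> bool" where
  "central_acting X T q f Z \<longleftrightarrow>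
     Z \<in> T \<and> (\<forall>M\<in>T. Z \<otimes>\<^bsub>mat_alg X\<^esub> M = M \<otimes>\<^bsub>mat_alg X\<^esub> Z) \<and>
     (\<forall>\<mu>. \<forall>v \<in> module.span cscale (\<Union>{W. irreducible_T_module X T W \<and> f W = \<mu>}).
        mat_vec X Z v = cscale (of_real (q powi \<mu>)) v)"

definition is_Upsilon ::
    "'a set \<Rightarrow> 'a cmat \<Rightarrow> ('a \<Rightarrow> 'a \<Rightarrow> nat) \<Rightarrow> nat \<Rightarrow> 'a \<Rightarrow> real \<Rightarrow> 'a cmat \<Rightarrow> bool" where
  "is_Upsilon X A dst D x q \<Upsilon> \<longleftrightarrow> central_acting X (terwilliger_algebra X A x) q
     (\<lambda>W. int (endpoint X dst D x W) + int (dual_endpoint X A D W)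
          + int (module_diameter X dst D x W) - int D) \<Upsilon>"

definition is_Psi ::
    "'a set \<Rightarrow> 'a cmat \<Rightarrow> ('a \<Rightarrow> 'a \<Rightarrow> nat) \<Rightarrow> nat \<Rightarrow> 'a \<Rightarrow> real \<Rightarrow> 'a cmat \<Rightarrow> bool" where
  "is_Psi X A dst D x q \<Psi> \<longleftrightarrow> central_acting X (terwilliger_algebra X A x) q
     (\<lambda>W. int (endpoint X dst D x W) - int (dual_endpoint X A D W)) \<Psi>"


section \<open>The quantum algebra in its equitable presentation\<close>

datatype uq_gen = Gen_x | Gen_y | Gen_z | Gen_zinv

datatype uq_word = Word (letters: "uq_gen list")

instantiation uq_word :: monoid_add
begin
definition zero_uq_word :: uq_word where "zero_uq_word = Word []"
definition plus_uq_word :: "uq_word \<Rightarrow> uq_word \<Rightarrow> uq_word" where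
  "plus_uq_word u v = Word (letters u @ letters v)"
instance by standard (simp_all add: zero_uq_word_def plus_uq_word_def)
end

text \<open>
  Finitely supported functions on words, with convolution as multiplication, form the free
  unital associative complex algebra on the four generators.
\<close>

type_synonym uq_free = "uq_word \<Rightarrow>\<^sub>0 complex"

definition free_scalar :: "complex \<Rightarrow> uq_free" where
  "free_scalar c = Poly_Mapping.single 0 c"

definition free_gen :: "uq_gen \<Rightarrow> uq_free" where
  "free_gen g = Poly_Mapping.single (Word [g]) 1"

definition free_ring :: "uq_free ring" where
  "free_ring = \<lparr> carrier = UNIV, mult = (*), one = 1, zero = 0, add = (+) \<rparr>"

definition q_weyl_relator :: "complex \<Rightarrow> uq_free \<Rightarrow> uq_free \<Rightarrow> uq_free" where
  "q_weyl_relator q u v =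
     free_scalar (1 / (q - inverse q)) * (free_scalar q * u * v - free_scalar (inverse q) * v * u) - 1"

definition uq_relators :: "complex \<Rightarrow> uq_free set" where
  "uq_relators q =
     { free_gen Gen_z * free_gen Gen_zinv - 1,
       free_gen Gen_zinv * free_gen Gen_z - 1,
       q_weyl_relator q (free_gen Gen_x) (free_gen Gen_y),
       q_weyl_relator q (free_gen Gen_y) (free_gen Gen_z),
       q_weyl_relator q (free_gen Gen_z) (free_gen Gen_x) }"

definition uq_ideal :: "complex \<Rightarrow> uq_free set" where
  "uq_ideal q = Idl\<^bsub>free_ring\<^esub> (uq_relators q)"

definition Uq :: "complex \<Rightarrow> uq_free set ring" where
  "Uq q = free_ring Quot (uq_ideal q)"

definition uq_class :: "complex \<Rightarrow> uq_free \<Rightarrow> uq_free set" where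
  "uq_class q a = uq_ideal q +>\<^bsub>free_ring\<^esub> a"

definition uq_x :: "complex \<Rightarrow> uq_free set" where "uq_x q = uq_class q (free_gen Gen_x)"
definition uq_y :: "complex \<Rightarrow> uq_free set" where "uq_y q = uq_class q (free_gen Gen_y)"
definition uq_z :: "complex \<Rightarrow> uq_free set" where "uq_z q = uq_class q (free_gen Gen_z)"

text \<open>A ring homomorphism between unital complex algebras is linear iff it is compatible with
  the scalar multiples of the identity.\<close>

definition uq_representation :: "complex \<Rightarrow> 'a set \<Rightarrow> (uq_free set \<Rightarrow> 'a cmat) \<Rightarrow> bool" where
  "uq_representation q X \<pi> \<longleftrightarrow> \<pi> \<in> ring_hom (Uq q) (mat_alg X) \<and>
     (\<forall>c. \<pi> (uq_class q (free_scalar c)) = c \<odot>\<^bsub>mat_alg X\<^esub> \<one>\<^bsub>mat_alg X\<^esub>)"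


section \<open>The two module structures\<close>

text \<open>Below, \<open>b\<close> is the order of the field and \<open>q = sqrt b\<close>.\<close>

definition c_h :: "real \<Rightarrow> real \<Rightarrow> real" where
  "c_h q e = (1 - q powr (2 * e)) / (q\<^sup>2 - 1)"

definition c_hstar :: "real \<Rightarrow> nat \<Rightarrow> real \<Rightarrow> real" where
  "c_hstar b D e = - (b * (b powr (real D + e - 2) + 1) / (b - 1))"

definition c_kappa :: "real \<Rightarrow> nat \<Rightarrow> real \<Rightarrow> real" where
  "c_kappa q D e = q powr (2 * e + real D) / (q\<^sup>2 - 1)"

definition c_xi :: "real \<Rightarrow> nat \<Rightarrow> real \<Rightarrow> real" where
  "c_xi b D e = b\<^sup>2 * (b powr (real D + e - 2) + 1) * (b powr (real D + e - 1) + 1)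
     / ((b - 1) * (b powr e + b))"

definition c_kappastar :: "real \<Rightarrow> real \<Rightarrow> nat \<Rightarrow> real \<Rightarrow> real" where
  "c_kappastar b q D e = c_xi b D e * q powi (- int D)"

definition c_upsilon :: "real \<Rightarrow> nat \<Rightarrow> real" where
  "c_upsilon q D = - (q ^ D / (q\<^sup>2 - 1))"

definition first_module_structure ::
    "real \<Rightarrow> real \<Rightarrow> nat \<Rightarrow> real \<Rightarrow> 'a set \<Rightarrow> 'a cmat \<Rightarrow> 'a cmat \<Rightarrow> 'a cmat \<Rightarrow> 'a cmat
      \<Rightarrow> (uq_free set \<Rightarrow> 'a cmat) \<Rightarrow> bool" where
  "first_module_structure b q D e X A Astar \<Upsilon> \<Psi> \<pi> \<longleftrightarrow>
     (let R = mat_alg X; Q = complex_of_real q in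
      uq_representation Q X \<pi> \<and>
      A = of_real (c_h q e) \<odot>\<^bsub>R\<^esub> \<one>\<^bsub>R\<^esub>
          \<oplus>\<^bsub>R\<^esub> of_real (c_kappa q D e) \<odot>\<^bsub>R\<^esub> (inv\<^bsub>R\<^esub> \<Upsilon> \<otimes>\<^bsub>R\<^esub> \<Psi> \<otimes>\<^bsub>R\<^esub> \<pi> (uq_x Q))
          \<oplus>\<^bsub>R\<^esub> of_real (c_upsilon q D) \<odot>\<^bsub>R\<^esub> (\<Upsilon> \<otimes>\<^bsub>R\<^esub> inv\<^bsub>R\<^esub> \<Psi> \<otimes>\<^bsub>R\<^esub> \<pi> (uq_y Q)) \<and>
      Astar = of_real (c_hstar b D e) \<odot>\<^bsub>R\<^esub> \<one>\<^bsub>R\<^esub>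
          \<oplus>\<^bsub>R\<^esub> of_real (c_kappastar b q D e) \<odot>\<^bsub>R\<^esub>
               (inv\<^bsub>R\<^esub> \<Upsilon> \<otimes>\<^bsub>R\<^esub> inv\<^bsub>R\<^esub> \<Psi> \<otimes>\<^bsub>R\<^esub> \<pi> (uq_z Q)))"

definition second_module_structure ::
    "real \<Rightarrow> real \<Rightarrow> nat \<Rightarrow> real \<Rightarrow> 'a set \<Rightarrow> 'a cmat \<Rightarrow> 'a cmat \<Rightarrow> 'a cmat \<Rightarrow> 'a cmat
      \<Rightarrow> (uq_free set \<Rightarrow> 'a cmat) \<Rightarrow> bool" where
  "second_module_structure b q D e X A Astar \<Upsilon> \<Psi> \<pi> \<longleftrightarrow>
     (let R = mat_alg X; Q = complex_of_real q in
      uq_representation Q X \<pi> \<and>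
      A = of_real (c_h q e) \<odot>\<^bsub>R\<^esub> \<one>\<^bsub>R\<^esub>
          \<oplus>\<^bsub>R\<^esub> of_real (c_kappa q D e) \<odot>\<^bsub>R\<^esub> (inv\<^bsub>R\<^esub> \<Upsilon> \<otimes>\<^bsub>R\<^esub> \<Psi> \<otimes>\<^bsub>R\<^esub> \<pi> (uq_y Q))
          \<oplus>\<^bsub>R\<^esub> of_real (c_upsilon q D) \<odot>\<^bsub>R\<^esub> (\<Upsilon> \<otimes>\<^bsub>R\<^esub> inv\<^bsub>R\<^esub> \<Psi> \<otimes>\<^bsub>R\<^esub> \<pi> (uq_x Q)) \<and>
      Astar = of_real (c_hstar b D e) \<odot>\<^bsub>R\<^esub> \<one>\<^bsub>R\<^esub>
          \<oplus>\<^bsub>R\<^esub> of_real (c_kappastar b q D e) \<odot>\<^bsub>R\<^esub>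
               (inv\<^bsub>R\<^esub> \<Upsilon> \<otimes>\<^bsub>R\<^esub> inv\<^bsub>R\<^esub> \<Psi> \<otimes>\<^bsub>R\<^esub> \<pi> (uq_z Q)))"

end

theory Submission
  imports Defs
begin

text \<open>
  Put \<open>a = \<kappa> \<Upsilon>\<^sup>-\<^sup>1 \<Psi>\<close> and \<open>d = \<upsilon> \<Upsilon> \<Psi>\<^sup>-\<^sup>1\<close>. The expressions for the dual adjacency matrix give
  \<open>\<pi>\<^sub>1(z) = \<pi>\<^sub>2(z) = Z\<close>, which commutes with \<open>a\<close> and \<open>d\<close> because \<open>\<Upsilon>\<close> and \<open>\<Psi>\<close> are central in \<open>T\<close>. By the
  equitable relations, conjugation by \<open>Z\<close> multiplies \<open>x - Z\<^sup>-\<^sup>1\<close> by \<open>q\<^sup>-\<^sup>2\<close> and \<open>y - Z\<^sup>-\<^sup>1\<close> by \<open>q\<^sup>2\<close>. Hence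
  both expressions for the adjacency matrix split \<open>A - h - (a + d) Z\<^sup>-\<^sup>1\<close> into eigenvectors of this
  conjugation, and comparing the components gives \<open>d (x\<^sub>2 - Z\<^sup>-\<^sup>1) = a (x\<^sub>1 - Z\<^sup>-\<^sup>1)\<close> and
  \<open>a (y\<^sub>2 - Z\<^sup>-\<^sup>1) = d (y\<^sub>1 - Z\<^sup>-\<^sup>1)\<close>. The elements \<open>\<Upsilon>\<close> and \<open>\<Psi>\<close> are invertible because they act as nonzero
  scalars on every irreducible \<open>T\<close>-module.
\<close>

section \<open>Complex algebras\<close>

text \<open>The scalars are the type \<open>complex\<close> itself rather than a ring record, so
  arithmetic on coefficients such as \<open>q - inverse q\<close> is ordinary field
  arithmetic.\<close>

locale complex_algebra = ring R for R :: "(complex, 'a, 'm) module_scheme" (structure) +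
  assumes smult_closed [simp, intro]: "x \<in> carrier R \<Longrightarrow> c \<odot> x \<in> carrier R"
    and smult_add_left: "x \<in> carrier R \<Longrightarrow> (c + d) \<odot> x = c \<odot> x \<oplus> d \<odot> x"
    and smult_add_right: "x \<in> carrier R \<Longrightarrow> y \<in> carrier R \<Longrightarrow> c \<odot> (x \<oplus> y) = c \<odot> x \<oplus> c \<odot> y"
    and smult_smult: "x \<in> carrier R \<Longrightarrow> c \<odot> (d \<odot> x) = (c * d) \<odot> x"
    and smult_one [simp]: "x \<in> carrier R \<Longrightarrow> 1 \<odot> x = x"
    and smult_mult_left: "x \<in> carrier R \<Longrightarrow> y \<in> carrier R \<Longrightarrow> (c \<odot> x) \<otimes> y = c \<odot> (x \<otimes> y)"
    and smult_mult_right: "x \<in> carrier R \<Longrightarrow> y \<in> carrier R \<Longrightarrow> x \<otimes> (c \<odot> y) = c \<odot> (x \<otimes> y)"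
begin

lemma smult_zero_left [simp]: "x \<in> carrier R \<Longrightarrow> 0 \<odot> x = \<zero>"
  by (metis add.l_cancel_one add_0 smult_add_left smult_closed)

lemma smult_zero_right [simp]: "c \<odot> \<zero> = \<zero>"
  using smult_smult[of \<zero> c 0] by simp

lemma smult_minus: "x \<in> carrier R \<Longrightarrow> (- c) \<odot> x = \<ominus> (c \<odot> x)"
  using smult_add_left[of x "- c" c] by (simp add: minus_equality)

lemma smult_uminus_right: "x \<in> carrier R \<Longrightarrow> c \<odot> (\<ominus> x) = \<ominus> (c \<odot> x)"
  using smult_smult[of x c "-1"] smult_minus[of x c] smult_minus[of x 1] by simp

lemma smult_diff_right:
  "x \<in> carrier R \<Longrightarrow> y \<in> carrier R \<Longrightarrow> c \<odot> (x \<ominus> y) = c \<odot> x \<ominus> c \<odot> y"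
  by (simp add: minus_eq smult_add_right smult_uminus_right)

lemma smult_diff_left: "x \<in> carrier R \<Longrightarrow> (c - d) \<odot> x = c \<odot> x \<ominus> d \<odot> x"
  using smult_add_left[of x c "- d"] by (simp add: minus_eq smult_minus)

lemma smult_cancel:
  assumes "c \<noteq> 0" "x \<in> carrier R" "y \<in> carrier R" "c \<odot> x = c \<odot> y"
  shows "x = y"
  using assms by (metis left_inverse smult_one smult_smult)

lemma diff_mult_distrib_right:
  "\<lbrakk>x \<in> carrier R; y \<in> carrier R; z \<in> carrier R\<rbrakk> \<Longrightarrow> (x \<ominus> y) \<otimes> z = x \<otimes> z \<ominus> y \<otimes> z"
  by (simp add: minus_eq l_distr l_minus)

lemma diff_mult_distrib_left:
  "\<lbrakk>x \<in> carrier R; y \<in> carrier R; z \<in> carrier R\<rbrakk> \<Longrightarrow> z \<otimes> (x \<ominus> y) = z \<otimes> x \<ominus> z \<otimes> y"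
  by (simp add: minus_eq r_distr r_minus)

lemma diff_eq_diffI:
  assumes "x \<oplus> w = y \<oplus> z" "x \<in> carrier R" "y \<in> carrier R" "z \<in> carrier R" "w \<in> carrier R"
  shows "x \<ominus> z = y \<ominus> w"
proof -
  have "(x \<ominus> z) \<oplus> (z \<oplus> w) = x \<oplus> w"
    using assms(2-5) by (simp add: minus_eq a_assoc r_neg1)
  also have "\<dots> = (y \<ominus> w) \<oplus> (w \<oplus> z)"
    unfolding assms(1) using assms(2-5) by (simp add: minus_eq a_assoc r_neg1)
  also have "w \<oplus> z = z \<oplus> w"
    using assms(4,5) by (rule a_comm[rotated])
  finally show ?thesis
    using assms(2-5) by simp
qed

lemma eq_of_diff_eq:
  assumes "x \<ominus> z = y \<ominus> w" "x \<in> carrier R" "y \<in> carrier R" "z \<in> carrier R" "w \<in> carrier R"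
  shows "x \<oplus> w = y \<oplus> z"
  using diff_eq_diffI[of x "\<ominus> z" y "\<ominus> w"] assms by (simp add: minus_eq)

lemma eq_if_diff_zero:
  assumes "x \<ominus> y = \<zero>" "x \<in> carrier R" "y \<in> carrier R"
  shows "x = y"
  using eq_of_diff_eq[of x y \<zero> \<zero>] assms by (simp add: minus_eq)

section \<open>Commutation with a unit and conjugation by it\<close>

lemma commutes_inv:
  assumes "u \<in> Units R" "z \<in> carrier R" "u \<otimes> z = z \<otimes> u"
  shows "inv u \<otimes> z = z \<otimes> inv u"
proof -
  have uc: "u \<in> carrier R" "inv u \<in> carrier R" using assms(1) by auto
  have "inv u \<otimes> z = inv u \<otimes> (z \<otimes> (u \<otimes> inv u))"
    using assms(1,2) by simp
  also have "\<dots> = inv u \<otimes> (u \<otimes> z \<otimes> inv u)"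
    using uc assms(2) unfolding assms(3) by (simp only: m_assoc)
  also have "\<dots> = inv u \<otimes> u \<otimes> z \<otimes> inv u"
    using uc assms(2) by (simp only: m_assoc m_closed)
  also have "\<dots> = z \<otimes> inv u"
    using assms(1,2) by simp
  finally show ?thesis .
qed

lemma commutes_mult:
  assumes "u \<in> carrier R" "v \<in> carrier R" "z \<in> carrier R"
    and "u \<otimes> z = z \<otimes> u" "v \<otimes> z = z \<otimes> v"
  shows "u \<otimes> v \<otimes> z = z \<otimes> (u \<otimes> v)"
  using assms by (metis m_assoc)

text \<open>Writing \<open>\<one>\<close> as \<open>z \<otimes> inv z\<close> on one side and as
  \<open>inv z \<otimes> z\<close> on the other absorbs the constant of the relation, leaving
  \<open>s \<odot> (z \<otimes> (x \<ominus> inv z)) = inverse s \<odot> ((x \<ominus> inv z)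
  \<otimes> z)\<close>. The factor \<open>a\<close> passes through \<open>z\<close>. The parameter
  \<open>s\<close> is kept free because it is later taken to be both \<open>q\<close> and
  \<open>- inverse q\<close>.\<close>

lemma shift_q_commutes:
  assumes z: "z \<in> Units R" and x: "x \<in> carrier R" and a: "a \<in> carrier R"
    and az: "a \<otimes> z = z \<otimes> a" and s: "s \<noteq> 0"
    and rel: "s \<odot> (z \<otimes> x) \<ominus> inverse s \<odot> (x \<otimes> z) = (s - inverse s) \<odot> \<one>"
  shows "z \<otimes> (a \<otimes> (x \<ominus> inv z)) = (inverse s)\<^sup>2 \<odot> (a \<otimes> (x \<ominus> inv z) \<otimes> z)"
proof -
  have zc: "z \<in> carrier R" and ic: "inv z \<in> carrier R" using z by auto
  have "s \<odot> (z \<otimes> x) \<oplus> inverse s \<odot> \<one> = s \<odot> \<one> \<oplus> inverse s \<odot> (x \<otimes> z)"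
    using rel x zc by (intro eq_of_diff_eq) (simp_all add: smult_diff_left)
  then have "s \<odot> (z \<otimes> x) \<ominus> s \<odot> \<one> = inverse s \<odot> (x \<otimes> z) \<ominus> inverse s \<odot> \<one>"
    using x zc by (intro diff_eq_diffI) (simp_all add: a_comm)
  then have "s \<odot> (z \<otimes> (x \<ominus> inv z)) = inverse s \<odot> ((x \<ominus> inv z) \<otimes> z)"
    using x zc ic z by (simp add: smult_diff_right diff_mult_distrib_right diff_mult_distrib_left)
  then have "inverse s \<odot> (s \<odot> (z \<otimes> (x \<ominus> inv z))) = inverse s \<odot> (inverse s \<odot> ((x \<ominus> inv z) \<otimes> z))"
    by simp
  then have *: "z \<otimes> (x \<ominus> inv z) = (inverse s)\<^sup>2 \<odot> ((x \<ominus> inv z) \<otimes> z)"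
    using x zc ic s by (simp add: smult_smult power2_eq_square)
  have "z \<otimes> (a \<otimes> (x \<ominus> inv z)) = a \<otimes> (z \<otimes> (x \<ominus> inv z))"
    using x zc ic a az by (metis m_assoc minus_closed)
  then show ?thesis
    using x zc ic a by (simp add: * smult_mult_right m_assoc)
qed

text \<open>The summands of \<open>p \<oplus> s\<close> are eigenvectors of conjugation by \<open>z\<close> for the distinct
  eigenvalues \<open>k\<close> and \<open>l\<close>.\<close>

lemma conjugation_eigen_unique:
  assumes z: "z \<in> Units R" and kl: "k \<noteq> l"
    and c: "p \<in> carrier R" "s \<in> carrier R" "p' \<in> carrier R" "s' \<in> carrier R"
    and eq: "p \<oplus> s = p' \<oplus> s'"
    and p: "z \<otimes> p = k \<odot> (p \<otimes> z)" "z \<otimes> p' = k \<odot> (p' \<otimes> z)"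
    and s: "z \<otimes> s = l \<odot> (s \<otimes> z)" "z \<otimes> s' = l \<odot> (s' \<otimes> z)"
  shows "p = p'" "s = s'"
proof -
  have zc: "z \<in> carrier R" using z by auto
  \<comment> \<open>The difference \<open>p \<ominus> p'\<close> equals
    \<open>s' \<ominus> s\<close>, so it is an eigenvector for \<open>k\<close> and for
    \<open>l\<close> at once. Since \<open>k \<noteq> l\<close> and \<open>z\<close> is a unit, it
    vanishes.\<close>
  define n where "n = p \<ominus> p'"
  have n2: "n = s' \<ominus> s"
    unfolding n_def using eq c by (intro diff_eq_diffI) (simp_all add: a_comm)
  have nc: "n \<in> carrier R" using c by (simp add: n_def)
  have "z \<otimes> n = k \<odot> (n \<otimes> z)"
    using c zc p by (simp add: n_def smult_diff_right diff_mult_distrib_right diff_mult_distrib_left)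
  moreover have "z \<otimes> n = l \<odot> (n \<otimes> z)"
    using c zc s by (simp add: n2 smult_diff_right diff_mult_distrib_right diff_mult_distrib_left)
  ultimately have "(k - l) \<odot> (n \<otimes> z) = \<zero>"
    using nc zc by (simp add: smult_diff_left r_neg minus_eq)
  then have "n \<otimes> z = \<zero>"
    using smult_cancel[of "k - l" "n \<otimes> z" \<zero>] kl nc zc by simp
  then have "n = \<zero>"
    using nc z zc by (metis Units_r_inv Units_inv_closed l_null m_assoc r_one)
  then show pp: "p = p'"
    using c eq_if_diff_zero by (simp add: n_def)
  show "s = s'"
    using eq c unfolding pp by simp
qed

text \<open>The hypotheses on \<open>x\<close> and \<open>y\<close> are the second and third relations of the equitable
  presentation.\<close>

lemma shifted_generators_eq:
  assumes z: "z \<in> Units R" and c: "x \<in> carrier R" "y \<in> carrier R" "x' \<in> carrier R" "y' \<in> carrier R"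
    and a: "a \<in> carrier R" "a \<otimes> z = z \<otimes> a" and d: "d \<in> carrier R" "d \<otimes> z = z \<otimes> d"
    and q: "q \<noteq> 0" "q ^ 4 \<noteq> 1"
    and x: "q \<odot> (z \<otimes> x) \<ominus> inverse q \<odot> (x \<otimes> z) = (q - inverse q) \<odot> \<one>"
    and y: "q \<odot> (y \<otimes> z) \<ominus> inverse q \<odot> (z \<otimes> y) = (q - inverse q) \<odot> \<one>"
    and x': "q \<odot> (z \<otimes> x') \<ominus> inverse q \<odot> (x' \<otimes> z) = (q - inverse q) \<odot> \<one>"
    and y': "q \<odot> (y' \<otimes> z) \<ominus> inverse q \<odot> (z \<otimes> y') = (q - inverse q) \<odot> \<one>"
    and eq: "a \<otimes> x \<oplus> d \<otimes> y = a \<otimes> y' \<oplus> d \<otimes> x'"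
  shows "d \<otimes> (x' \<ominus> inv z) = a \<otimes> (x \<ominus> inv z)" "a \<otimes> (y' \<ominus> inv z) = d \<otimes> (y \<ominus> inv z)"
proof -
  have zc: "z \<in> carrier R" and ic: "inv z \<in> carrier R" using z by auto
  \<comment> \<open>The relation for \<open>y\<close> has the order of the factors reversed. It is
    the relation for \<open>x\<close> with \<open>q\<close> replaced by \<open>- inverse q\<close>,
    so the same lemma serves both generators.\<close>
  have yrel: "(- inverse q) \<odot> (z \<otimes> v) \<ominus> inverse (- inverse q) \<odot> (v \<otimes> z)
      = ((- inverse q) - inverse (- inverse q)) \<odot> \<one>"
    if "v \<in> carrier R" "q \<odot> (v \<otimes> z) \<ominus> inverse q \<odot> (z \<otimes> v) = (q - inverse q) \<odot> \<one>" for v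
    using that zc by (simp add: smult_minus minus_eq a_comm)
  \<comment> \<open>The two eigenvalues are the inverse square of \<open>q\<close> and the square of
    \<open>q\<close>; they differ exactly because \<open>q ^ 4 \<noteq> 1\<close>.\<close>
  have kl: "(inverse q)\<^sup>2 \<noteq> (inverse (- inverse q))\<^sup>2"
    using q by (auto simp: field_simps power2_eq_square power4_eq_xxxx)
  note sx = shift_q_commutes[OF z _ _ _ q(1)]
  have nq: "- inverse q \<noteq> 0" using q by simp
  note sy = shift_q_commutes[OF z _ _ _ nq yrel]
  \<comment> \<open>The correction \<open>(a \<oplus> d) \<otimes> inv z\<close> does not depend on
    which generator stands beside \<open>a\<close> and which beside \<open>d\<close>, so it can be
    subtracted from both sides of \<open>eq\<close>.\<close>
  have e: "(a \<otimes> v \<oplus> d \<otimes> w) \<ominus> (a \<oplus> d) \<otimes> inv z = a \<otimes> (v \<ominus> inv z) \<oplus> d \<otimes> (w \<ominus> inv z)"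
    if "v \<in> carrier R" "w \<in> carrier R" for v w
    using that a d ic by (simp add: minus_eq r_distr l_distr r_minus minus_add a_ac)
  \<comment> \<open>On the right the summands are exchanged: \<open>x'\<close> carries
    \<open>d\<close> and \<open>y'\<close> carries \<open>a\<close>, and the components with equal
    eigenvalue must stand in the same position.\<close>
  have "a \<otimes> (x \<ominus> inv z) \<oplus> d \<otimes> (y \<ominus> inv z) = d \<otimes> (x' \<ominus> inv z) \<oplus> a \<otimes> (y' \<ominus> inv z)"
    using e[OF c(1,2)] e[OF c(4,3)] eq c a d ic by (simp add: a_comm)
  note u = conjugation_eigen_unique[OF z kl _ _ _ _ this sx[OF c(1) a x] sx[OF c(3) d x']
      sy[OF c(2) d c(2) y] sy[OF c(4) a c(4) y']]
  show "d \<otimes> (x' \<ominus> inv z) = a \<otimes> (x \<ominus> inv z)" "a \<otimes> (y' \<ominus> inv z) = d \<otimes> (y \<ominus> inv z)"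
    using u c a d ic by simp_all
qed

text \<open>Multiplying by the left inverse \<open>d'\<close> isolates \<open>x' \<ominus> w\<close>
  and turns the coefficient \<open>a\<close> into \<open>d' \<otimes> a\<close>. The scalar of that
  product is called \<open>- k\<close> so that, after moving \<open>w\<close> across, the
  coefficient of \<open>w\<close> becomes \<open>\<one> \<oplus> k \<odot> g\<close>.\<close>

lemma solve_shifted:
  assumes eq: "d \<otimes> (x' \<ominus> w) = a \<otimes> (x \<ominus> w)"
    and c: "x \<in> carrier R" "x' \<in> carrier R" "w \<in> carrier R" "a \<in> carrier R" "d \<in> carrier R"
      "d' \<in> carrier R" "g \<in> carrier R"
    and d': "d' \<otimes> d = \<one>" and g: "d' \<otimes> a = (- k) \<odot> g"
  shows "x' = (- k) \<odot> (g \<otimes> x) \<oplus> (\<one> \<oplus> k \<odot> g) \<otimes> w"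
proof -
  have "d' \<otimes> d \<otimes> (x' \<ominus> w) = d' \<otimes> a \<otimes> (x \<ominus> w)"
    using eq c by (simp add: m_assoc)
  then have "x' \<ominus> w = (- k) \<odot> (g \<otimes> (x \<ominus> w))"
    using c by (simp add: d' g smult_mult_left)
  also have "\<dots> = (- k) \<odot> (g \<otimes> x) \<oplus> k \<odot> (g \<otimes> w)"
    using c by (simp add: minus_eq r_distr r_minus smult_add_right smult_minus smult_uminus_right)
  finally have "x' \<ominus> w = (- k) \<odot> (g \<otimes> x) \<oplus> k \<odot> (g \<otimes> w)" .
  moreover have "x' = (x' \<ominus> w) \<oplus> w"
    using c by (simp add: minus_eq a_assoc l_neg)
  ultimately have "x' = (- k) \<odot> (g \<otimes> x) \<oplus> k \<odot> (g \<otimes> w) \<oplus> w"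
    by simp
  then show ?thesis
    using c by (simp add: l_distr smult_mult_left a_ac)
qed

section \<open>Squares, cancellation and quotients of commuting units\<close>

lemma int_pow_two:
  assumes "u \<in> Units R"
  shows "u [^] (2::int) = u \<otimes> u" "u [^] (-2::int) = inv u \<otimes> inv u"
proof -
  have c: "u \<in> carrier R" "inv u \<in> carrier R" using assms by auto
  have n: "u [^] (2::nat) = u \<otimes> u"
    using c by (simp add: numeral_2_eq_2)
  then show "u [^] (2::int) = u \<otimes> u"
    by (simp add: int_pow_def2)
  have "(inv u \<otimes> inv u) \<otimes> (u \<otimes> u) = inv u \<otimes> (inv u \<otimes> u) \<otimes> u"
    using c by (simp only: m_assoc m_closed)
  then have l: "(inv u \<otimes> inv u) \<otimes> (u \<otimes> u) = \<one>"
    using assms c by simp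
  have "(u \<otimes> u) \<otimes> (inv u \<otimes> inv u) = u \<otimes> (u \<otimes> inv u) \<otimes> inv u"
    using c by (simp only: m_assoc m_closed)
  then have "(u \<otimes> u) \<otimes> (inv u \<otimes> inv u) = \<one>"
    using assms c by simp
  then have "inv u \<otimes> inv u = inv (u \<otimes> u)"
    using l c by (intro inv_unique') simp_all
  then show "u [^] (-2::int) = inv u \<otimes> inv u"
    by (simp add: int_pow_def2 n)
qed

text \<open>The sum has the shape of the dual adjacency matrix. Removing the multiple of
  \<open>\<one>\<close>, the scalar \<open>k\<close> and finally the unit \<open>v\<close> hands
  commutation with the sum down to the factor \<open>z\<close>.\<close>

lemma commutes_right_factor:
  assumes u: "u \<in> carrier R" and c: "v \<in> Units R" "z \<in> carrier R" and k: "k \<noteq> 0"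
    and uv: "u \<otimes> v = v \<otimes> u"
    and us: "u \<otimes> (h \<odot> \<one> \<oplus> k \<odot> (v \<otimes> z)) = (h \<odot> \<one> \<oplus> k \<odot> (v \<otimes> z)) \<otimes> u"
  shows "u \<otimes> z = z \<otimes> u"
proof -
  have vc: "v \<in> carrier R" using c by auto
  have "k \<odot> (u \<otimes> (v \<otimes> z)) = k \<odot> (v \<otimes> z \<otimes> u)"
    using us u c(2) vc
    by (simp add: r_distr l_distr smult_mult_left smult_mult_right)
  then have "u \<otimes> (v \<otimes> z) = v \<otimes> z \<otimes> u"
    using smult_cancel[OF k] u c(2) vc by simp
  then have "v \<otimes> (u \<otimes> z) = v \<otimes> (z \<otimes> u)"
    using u c(2) vc uv by (metis m_assoc)
  then show ?thesis
    using c u by simp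
qed

text \<open>The left factor is the left inverse demanded by \<open>solve_shifted\<close>, and the
  second product is the coefficient \<open>d' \<otimes> a\<close> there. Commutation of
  \<open>u\<close> and \<open>p\<close> collects the mixed product into squares. For the other
  generator the lemma is applied with \<open>u\<close> and \<open>p\<close> exchanged.\<close>

lemma unit_quotients:
  assumes u: "u \<in> Units R" and p: "p \<in> Units R" and up: "u \<otimes> p = p \<otimes> u" and k: "k \<noteq> 0"
  shows "(inverse k \<odot> (p \<otimes> inv u)) \<otimes> (k \<odot> (u \<otimes> inv p)) = \<one>"
    and "(inverse k \<odot> (p \<otimes> inv u)) \<otimes> (l \<odot> (inv u \<otimes> p)) = (l / k) \<odot> (u [^] (-2::int) \<otimes> p [^] (2::int))"
proof -
  have c: "u \<in> carrier R" "p \<in> carrier R" "inv u \<in> carrier R" "inv p \<in> carrier R"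
    using u p by auto
  have pu: "p \<otimes> inv u = inv u \<otimes> p"
    using commutes_inv[OF u c(2) up] by simp
  have "(p \<otimes> inv u) \<otimes> (u \<otimes> inv p) = p \<otimes> (inv u \<otimes> u) \<otimes> inv p"
    using c by (simp only: m_assoc m_closed)
  then have "(p \<otimes> inv u) \<otimes> (u \<otimes> inv p) = \<one>"
    using u p c by simp
  then show "(inverse k \<odot> (p \<otimes> inv u)) \<otimes> (k \<odot> (u \<otimes> inv p)) = \<one>"
    using c k by (simp add: smult_mult_left smult_mult_right smult_smult)
  have "(p \<otimes> inv u) \<otimes> (inv u \<otimes> p) = inv u \<otimes> (p \<otimes> inv u) \<otimes> p"
    using c by (subst pu) (simp add: m_assoc)
  also have "\<dots> = (inv u \<otimes> inv u) \<otimes> (p \<otimes> p)"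
    using c unfolding pu by (simp add: m_assoc)
  finally show "(inverse k \<odot> (p \<otimes> inv u)) \<otimes> (l \<odot> (inv u \<otimes> p))
      = (l / k) \<odot> (u [^] (-2::int) \<otimes> p [^] (2::int))"
    using c by (simp add: int_pow_two u p smult_mult_left smult_mult_right smult_smult field_simps)
qed

text \<open>The elements \<open>u\<close>, \<open>p\<close>, \<open>A\<close>, \<open>S\<close> are \<open>\<Upsilon>\<close>, \<open>\<Psi>\<close> and the adjacency and dual adjacency matrices.\<close>

lemma equitable_triples_related:
  assumes u: "u \<in> Units R" and p: "p \<in> Units R" and up: "u \<otimes> p = p \<otimes> u"
    and z: "z \<in> Units R" and z': "z' \<in> carrier R"
    and c: "x \<in> carrier R" "y \<in> carrier R" "x' \<in> carrier R" "y' \<in> carrier R"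
    and q: "q \<noteq> 0" "q ^ 4 \<noteq> 1" and nz: "k \<noteq> 0" "l \<noteq> 0" "m \<noteq> 0"
    and x: "q \<odot> (z \<otimes> x) \<ominus> inverse q \<odot> (x \<otimes> z) = (q - inverse q) \<odot> \<one>"
    and y: "q \<odot> (y \<otimes> z) \<ominus> inverse q \<odot> (z \<otimes> y) = (q - inverse q) \<odot> \<one>"
    and x': "q \<odot> (z' \<otimes> x') \<ominus> inverse q \<odot> (x' \<otimes> z') = (q - inverse q) \<odot> \<one>"
    and y': "q \<odot> (y' \<otimes> z') \<ominus> inverse q \<odot> (z' \<otimes> y') = (q - inverse q) \<odot> \<one>"
    and A: "A = h \<odot> \<one> \<oplus> k \<odot> (inv u \<otimes> p \<otimes> x) \<oplus> l \<odot> (u \<otimes> inv p \<otimes> y)"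
    and A': "A = h \<odot> \<one> \<oplus> k \<odot> (inv u \<otimes> p \<otimes> y') \<oplus> l \<odot> (u \<otimes> inv p \<otimes> x')"
    and S: "S = j \<odot> \<one> \<oplus> m \<odot> (inv u \<otimes> inv p \<otimes> z)"
    and S': "S = j \<odot> \<one> \<oplus> m \<odot> (inv u \<otimes> inv p \<otimes> z')"
    and comm: "u \<otimes> S = S \<otimes> u" "p \<otimes> S = S \<otimes> p"
    and g: "k / l = - g"
  shows "z' = z"
    and "x' = (- g) \<odot> (u [^] (-2::int) \<otimes> p [^] (2::int) \<otimes> x)
      \<oplus> (\<one> \<oplus> g \<odot> (u [^] (-2::int) \<otimes> p [^] (2::int))) \<otimes> inv z"
    and "y' = (- inverse g) \<odot> (u [^] (2::int) \<otimes> p [^] (-2::int) \<otimes> y)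
      \<oplus> (\<one> \<oplus> inverse g \<odot> (u [^] (2::int) \<otimes> p [^] (-2::int))) \<otimes> inv z"
proof -
  have uc: "u \<in> carrier R" "p \<in> carrier R" "inv u \<in> carrier R" "inv p \<in> carrier R"
    and zc: "z \<in> carrier R" "inv z \<in> carrier R"
    using u p z by auto
  have v: "inv u \<otimes> inv p \<in> Units R" using u p by simp
  have "m \<odot> (inv u \<otimes> inv p \<otimes> z') = m \<odot> (inv u \<otimes> inv p \<otimes> z)"
    using S S' uc zc z' by simp
  then have "inv u \<otimes> inv p \<otimes> z' = inv u \<otimes> inv p \<otimes> z"
    using smult_cancel[OF nz(3)] uc zc z' by simp
  then show zz: "z' = z"
    using v z' zc by simp
  have iup: "inv u \<otimes> p = p \<otimes> inv u" and ipu: "inv p \<otimes> u = u \<otimes> inv p"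
    using commutes_inv[OF u uc(2) up] commutes_inv[OF p uc(1)] up by simp_all
  have iui: "inv u \<otimes> u = u \<otimes> inv u" "inv p \<otimes> p = p \<otimes> inv p" using u p by simp_all
  \<comment> \<open>Only commutation with \<open>S\<close> is assumed; commutation with
    \<open>z\<close> is extracted from the expression of \<open>S\<close> through
    \<open>z\<close>.\<close>
  have uz: "u \<otimes> z = z \<otimes> u"
    using commutes_mult[OF uc(3,4,1) iui(1) ipu] comm(1) S
    by (intro commutes_right_factor[OF uc(1) v zc(1) nz(3)]) simp_all
  have pz: "p \<otimes> z = z \<otimes> p"
    using commutes_mult[OF uc(3,4,2) iup iui(2)] comm(2) S
    by (intro commutes_right_factor[OF uc(2) v zc(1) nz(3)]) simp_all
  have iz: "inv u \<otimes> z = z \<otimes> inv u" "inv p \<otimes> z = z \<otimes> inv p"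
    using commutes_inv u p zc uz pz by simp_all
  define a where "a = k \<odot> (inv u \<otimes> p)"
  define d where "d = l \<odot> (u \<otimes> inv p)"
  have a: "a \<in> carrier R" "a \<otimes> z = z \<otimes> a"
    using uc zc commutes_mult[OF uc(3,2) zc(1) iz(1) pz]
    by (simp_all add: a_def smult_mult_left smult_mult_right)
  have d: "d \<in> carrier R" "d \<otimes> z = z \<otimes> d"
    using uc zc commutes_mult[OF uc(1,4) zc(1) uz iz(2)]
    by (simp_all add: d_def smult_mult_left smult_mult_right)
  have "h \<odot> \<one> \<oplus> (a \<otimes> x \<oplus> d \<otimes> y) = h \<odot> \<one> \<oplus> (a \<otimes> y' \<oplus> d \<otimes> x')"
    using A A' uc c by (simp add: a_def d_def smult_mult_left a_assoc)
  then have eq: "a \<otimes> x \<oplus> d \<otimes> y = a \<otimes> y' \<oplus> d \<otimes> x'"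
    using a d c by simp
  note sh = shifted_generators_eq[OF z c a d q x y x'[unfolded zz] y'[unfolded zz] eq]
  \<comment> \<open>The formula for \<open>y'\<close> involves the reciprocal ratio
    \<open>l / k\<close>, which explains the coefficient \<open>inverse g\<close>.\<close>
  have g0: "g \<noteq> 0" "l / k = - inverse g" using g nz by (auto simp: field_simps)
  show "x' = (- g) \<odot> (u [^] (-2::int) \<otimes> p [^] (2::int) \<otimes> x)
      \<oplus> (\<one> \<oplus> g \<odot> (u [^] (-2::int) \<otimes> p [^] (2::int))) \<otimes> inv z"
    using unit_quotients[OF u p up nz(2)] uc zc a d c g
    by (intro solve_shifted[OF sh(1), where d' = "inverse l \<odot> (p \<otimes> inv u)"])
      (simp_all add: a_def d_def int_pow_two u p)
  show "y' = (- inverse g) \<odot> (u [^] (2::int) \<otimes> p [^] (-2::int) \<otimes> y)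
      \<oplus> (\<one> \<oplus> inverse g \<odot> (u [^] (2::int) \<otimes> p [^] (-2::int))) \<otimes> inv z"
  \<comment> \<open>With \<open>u\<close> and \<open>p\<close> exchanged,
    \<open>unit_quotients\<close> delivers the powers of \<open>p\<close> before those of
    \<open>u\<close>; \<open>pp\<close> restores the order of the claim.\<close>
  proof (rule solve_shifted[OF sh(2), where d' = "inverse k \<odot> (u \<otimes> inv p)"])
    have pc: "inv p \<otimes> inv p \<in> carrier R" using uc by simp
    have up2: "u \<otimes> (inv p \<otimes> inv p) = inv p \<otimes> inv p \<otimes> u"
      by (rule commutes_mult[OF uc(4,4,1) ipu ipu, symmetric])
    have pp: "p [^] (-2::int) \<otimes> u [^] (2::int) = u [^] (2::int) \<otimes> p [^] (-2::int)"
      unfolding int_pow_two[OF u] int_pow_two[OF p]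
      by (rule commutes_mult[OF uc(1,1) pc up2 up2, symmetric])
    show "inverse k \<odot> (u \<otimes> inv p) \<otimes> a = \<one>"
      using unit_quotients(1)[OF p u up[symmetric] nz(1)] by (simp add: a_def iup)
    show "inverse k \<odot> (u \<otimes> inv p) \<otimes> d = (- inverse g) \<odot> (u [^] (2::int) \<otimes> p [^] (-2::int))"
      using unit_quotients(2)[OF p u up[symmetric] nz(1), of l]
      by (simp add: d_def ipu pp g0(2))
  qed (use uc zc a d c in \<open>simp_all add: int_pow_two u p\<close>)
qed

end

section \<open>The matrix algebra\<close>

lemma mat_alg_simps:
  "carrier (mat_alg X) = {M. \<forall>y z. y \<notin> X \<or> z \<notin> X \<longrightarrow> M y z = 0}"
  "M \<otimes>\<^bsub>mat_alg X\<^esub> N = (\<lambda>y z. \<Sum>w\<in>X. M y w * N w z)"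
  "\<one>\<^bsub>mat_alg X\<^esub> = (\<lambda>y z. if y \<in> X \<and> y = z then 1 else 0)"
  "\<zero>\<^bsub>mat_alg X\<^esub> = (\<lambda>y z. 0)"
  "M \<oplus>\<^bsub>mat_alg X\<^esub> N = (\<lambda>y z. M y z + N y z)"
  "c \<odot>\<^bsub>mat_alg X\<^esub> M = (\<lambda>y z. c * M y z)"
  by (simp_all add: mat_alg_def)

lemma complex_algebra_mat_alg:
  assumes "finite X"
  shows "complex_algebra (mat_alg X)"
proof
  fix M N L :: "'a cmat" and c d :: complex
  let ?R = "mat_alg X"
  show "\<one>\<^bsub>?R\<^esub> \<otimes>\<^bsub>?R\<^esub> M = M" if "M \<in> carrier ?R"
  proof (intro ext)
    fix y z
    have "(\<Sum>w\<in>X. (if y \<in> X \<and> y = w then 1 else 0) * M w z) = (\<Sum>w\<in>X. if y = w then M w z else 0)"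
      by (intro sum.cong) auto
    then show "(\<one>\<^bsub>?R\<^esub> \<otimes>\<^bsub>?R\<^esub> M) y z = M y z"
      using that assms by (auto simp: mat_alg_simps)
  qed
  show "M \<otimes>\<^bsub>?R\<^esub> \<one>\<^bsub>?R\<^esub> = M" if "M \<in> carrier ?R"
  proof (intro ext)
    fix y z
    have "(\<Sum>w\<in>X. M y w * (if w \<in> X \<and> w = z then 1 else 0)) = (\<Sum>w\<in>X. if z = w then M y w else 0)"
      by (intro sum.cong) auto
    then show "(M \<otimes>\<^bsub>?R\<^esub> \<one>\<^bsub>?R\<^esub>) y z = M y z"
      using that assms by (auto simp: mat_alg_simps)
  qed
  show "(M \<otimes>\<^bsub>?R\<^esub> N) \<otimes>\<^bsub>?R\<^esub> L = M \<otimes>\<^bsub>?R\<^esub> (N \<otimes>\<^bsub>?R\<^esub> L)"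
    by (simp add: mat_alg_simps sum_distrib_left sum_distrib_right mult.assoc fun_eq_iff)
       (intro allI, rule sum.swap)
  show "carrier (add_monoid ?R) \<subseteq> Units (add_monoid ?R)"
  proof
    fix N :: "'a cmat"
    assume "N \<in> carrier (add_monoid ?R)"
    moreover from this have "(\<lambda>y z. - N y z) \<in> carrier (add_monoid ?R)"
      by (simp add: mat_alg_simps)
    moreover have "N \<oplus>\<^bsub>?R\<^esub> (\<lambda>y z. - N y z) = \<zero>\<^bsub>?R\<^esub>" "(\<lambda>y z. - N y z) \<oplus>\<^bsub>?R\<^esub> N = \<zero>\<^bsub>?R\<^esub>"
      by (simp_all add: mat_alg_simps)
    ultimately show "N \<in> Units (add_monoid ?R)"
      unfolding Units_def by auto
  qed
  show "(c + d) \<odot>\<^bsub>?R\<^esub> M = c \<odot>\<^bsub>?R\<^esub> M \<oplus>\<^bsub>?R\<^esub> d \<odot>\<^bsub>?R\<^esub> M"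
    "c \<odot>\<^bsub>?R\<^esub> (M \<oplus>\<^bsub>?R\<^esub> N) = c \<odot>\<^bsub>?R\<^esub> M \<oplus>\<^bsub>?R\<^esub> c \<odot>\<^bsub>?R\<^esub> N"
    "c \<odot>\<^bsub>?R\<^esub> (d \<odot>\<^bsub>?R\<^esub> M) = (c * d) \<odot>\<^bsub>?R\<^esub> M" "1 \<odot>\<^bsub>?R\<^esub> M = M"
    by (simp_all add: mat_alg_simps distrib_left distrib_right mult.assoc)
  show "(c \<odot>\<^bsub>?R\<^esub> M) \<otimes>\<^bsub>?R\<^esub> N = c \<odot>\<^bsub>?R\<^esub> (M \<otimes>\<^bsub>?R\<^esub> N)"
    "M \<otimes>\<^bsub>?R\<^esub> (c \<odot>\<^bsub>?R\<^esub> N) = c \<odot>\<^bsub>?R\<^esub> (M \<otimes>\<^bsub>?R\<^esub> N)"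
    by (simp_all add: mat_alg_simps sum_distrib_left mult.assoc mult.left_commute)
  show "(M \<oplus>\<^bsub>?R\<^esub> N) \<otimes>\<^bsub>?R\<^esub> L = M \<otimes>\<^bsub>?R\<^esub> L \<oplus>\<^bsub>?R\<^esub> N \<otimes>\<^bsub>?R\<^esub> L"
    "L \<otimes>\<^bsub>?R\<^esub> (M \<oplus>\<^bsub>?R\<^esub> N) = L \<otimes>\<^bsub>?R\<^esub> M \<oplus>\<^bsub>?R\<^esub> L \<otimes>\<^bsub>?R\<^esub> N"
    by (simp_all add: mat_alg_simps distrib_left distrib_right sum.distrib)
  show "M \<otimes>\<^bsub>?R\<^esub> N \<in> carrier ?R" if "M \<in> carrier ?R" "N \<in> carrier ?R"
    using that by (auto simp: mat_alg_simps)
qed (simp_all add: mat_alg_simps add_ac)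

section \<open>Vectors as a complex vector space, and invertibility of matrices\<close>

lemma vector_space_cscale: "vector_space cscale"
  by standard (simp_all add: cscale_def fun_eq_iff algebra_simps)

text \<open>A basis is chosen among the unit vectors. It spans all functions on the index type, not
  only those supported on \<open>X\<close>, so the index type itself has to be finite.\<close>

lemma finite_dimensional_cscale:
  assumes "finite (UNIV :: 'a set)"
  shows "\<exists>B :: 'a cvec set. finite_dimensional_vector_space cscale B"
proof -
  interpret vector_space "cscale :: complex \<Rightarrow> 'a cvec \<Rightarrow> _" by (rule vector_space_cscale)
  define E :: "'a cvec set" where "E = range (\<lambda>y z. if z = y then 1 else 0)"
  obtain B :: "'a cvec set" where B: "B \<subseteq> E" "independent B" "E \<subseteq> span B"
    by (rule maximal_independent_subset)
  have "v \<in> span B" for v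
  proof -
    have v: "v = (\<Sum>y\<in>UNIV. cscale (v y) (\<lambda>z. if z = y then 1 else 0))"
    proof
      fix x
      have "(\<Sum>y\<in>S. cscale (v y) (\<lambda>z. if z = y then 1 else 0)) x = (\<Sum>y\<in>S. if x = y then v y else 0)"
        for S
        by (induction S rule: infinite_finite_induct) (simp_all add: cscale_def)
      then show "v x = (\<Sum>y\<in>UNIV. cscale (v y) (\<lambda>z. if z = y then 1 else 0)) x"
        using assms by simp
    qed
    have "(\<lambda>z. if z = y then 1 else 0) \<in> span B" for y :: 'a
      using B(3) by (auto simp: E_def)
    then show ?thesis
      by (subst v) (intro span_sum span_scale)
  qed
  then have "finite_dimensional_vector_space cscale B"
    using B assms by unfold_locales (auto simp: E_def intro: finite_subset)
  then show ?thesis ..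
qed

lemma mat_vec_mult:
  "mat_vec X (M \<otimes>\<^bsub>mat_alg X\<^esub> N) v = mat_vec X M (mat_vec X N v)"
  by (simp add: mat_alg_simps mat_vec_def sum_distrib_left sum_distrib_right mult.assoc fun_eq_iff)
     (intro allI, rule sum.swap)

lemma mat_vec_add: "mat_vec X M (v + w) = mat_vec X M v + mat_vec X M w"
  by (simp add: mat_vec_def fun_eq_iff distrib_left sum.distrib)

lemma mat_vec_cscale: "mat_vec X M (cscale c v) = cscale c (mat_vec X M v)"
  by (simp add: mat_vec_def fun_eq_iff cscale_def sum_distrib_left mult.left_commute)

lemma mat_vec_zero: "mat_vec X M 0 = 0"
  by (simp add: mat_vec_def fun_eq_iff)

lemma mat_vec_in_vecs: "M \<in> carrier (mat_alg X) \<Longrightarrow> mat_vec X M v \<in> vecs X"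
  by (simp add: mat_vec_def vecs_def mat_alg_simps)

text \<open>An injective endomorphism of a finite-dimensional space is surjective. Preimages of unit
  vectors form a right inverse, and the trivial kernel makes it a left inverse too.\<close>

lemma mat_alg_Units_if_kernel_trivial:
  fixes M :: "'a cmat"
  assumes fin: "finite (UNIV :: 'a set)" and M: "M \<in> carrier (mat_alg X)"
    and ker: "\<And>v. v \<in> vecs X \<Longrightarrow> mat_vec X M v = 0 \<Longrightarrow> v = 0"
  shows "M \<in> Units (mat_alg X)"
proof -
  let ?R = "mat_alg X"
  have finX: "finite X" using fin by (rule rev_finite_subset) simp
  interpret complex_algebra ?R by (rule complex_algebra_mat_alg[OF finX])
  obtain B :: "'a cvec set" where "finite_dimensional_vector_space cscale B"
    using finite_dimensional_cscale[OF fin] by blast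
  then interpret fd: finite_dimensional_vector_space "cscale :: complex \<Rightarrow> 'a cvec \<Rightarrow> _" B .
  \<comment> \<open>Acting as the identity off \<open>X\<close> extends \<open>M\<close> to an
    injective endomorphism of the full function space.\<close>
  define L where "L v = (\<lambda>y. if y \<in> X then mat_vec X M v y else v y)" for v
  have lin: "Vector_Spaces.linear cscale cscale L"
    unfolding Vector_Spaces.linear_iff
    using vector_space_cscale
    by (auto simp: L_def mat_vec_add fun_eq_iff cscale_def mat_vec_cscale[unfolded cscale_def])
  have L0: "v = 0" if "L v = 0" for v
  proof (rule ker)
    show "v \<in> vecs X"
      using that unfolding L_def vecs_def fun_eq_iff by (auto split: if_splits)
    show "mat_vec X M v = 0"
    proof
      fix y
      show "mat_vec X M v y = 0 y"
        using fun_cong[OF that, of y] mat_vec_in_vecs[OF M, of v]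
        by (auto simp: L_def vecs_def split: if_splits)
    qed
  qed
  interpret L: Vector_Spaces.linear cscale cscale L by (rule lin)
  have "inj L"
  proof (rule injI)
    fix v w assume "L v = L w"
    then have "L (v - w) = 0" by (simp add: L.diff)
    then show "v = w" using L0 by fastforce
  qed
  then have surj: "surj L" by (rule fd.linear_inj_imp_surj[OF lin])
  define col where "col z = Hilbert_Choice.inv L (\<lambda>y. if y = z then 1 else 0)" for z
  have col: "L (col z) = (\<lambda>y. if y = z then 1 else 0)" for z
    unfolding col_def by (rule surj_f_inv_f[OF surj])
  define N where "N = (\<lambda>y z. if z \<in> X then col z y else 0)"
  have N: "N \<in> carrier ?R"
  proof -
    have "col z y = 0" if "z \<in> X" "y \<notin> X" for y z
      using fun_cong[OF col, of z y] that by (auto simp: L_def split: if_splits)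
    then show ?thesis by (auto simp: N_def mat_alg_simps)
  qed
  have MN: "M \<otimes>\<^bsub>?R\<^esub> N = \<one>\<^bsub>?R\<^esub>"
  proof (intro ext)
    fix y z
    show "(M \<otimes>\<^bsub>?R\<^esub> N) y z = \<one>\<^bsub>?R\<^esub> y z"
      using M fun_cong[OF col, of z y]
      by (cases "z \<in> X") (auto simp: mat_alg_simps N_def L_def mat_vec_def split: if_splits)
  qed
  \<comment> \<open>Each column of \<open>K\<close> lies in the kernel of \<open>M\<close>, because
    \<open>M \<otimes> N = \<one>\<close> gives \<open>M \<otimes> K = \<zero>\<close>.\<close>
  define K where "K = N \<otimes>\<^bsub>?R\<^esub> M \<ominus>\<^bsub>?R\<^esub> \<one>\<^bsub>?R\<^esub>"
  have K: "K \<in> carrier ?R" using M N by (simp add: K_def)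
  have MNM: "M \<otimes>\<^bsub>?R\<^esub> (N \<otimes>\<^bsub>?R\<^esub> M) = M"
    using M N MN by (metis m_assoc l_one)
  have MK: "M \<otimes>\<^bsub>?R\<^esub> K = \<zero>\<^bsub>?R\<^esub>"
    using M N unfolding K_def by (simp add: diff_mult_distrib_left MNM) (simp add: minus_eq r_neg)
  have "K = \<zero>\<^bsub>?R\<^esub>"
  proof (intro ext)
    fix y z
    have "(\<lambda>y. K y z) = 0"
    proof (rule ker)
      show "(\<lambda>y. K y z) \<in> vecs X" using K by (simp add: vecs_def mat_alg_simps)
      show "mat_vec X M (\<lambda>y. K y z) = 0"
        using MK by (simp add: mat_alg_simps mat_vec_def fun_eq_iff)
    qed
    then show "K y z = \<zero>\<^bsub>?R\<^esub> y z" by (simp add: mat_alg_simps fun_eq_iff)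
  qed
  then have "N \<otimes>\<^bsub>?R\<^esub> M = \<one>\<^bsub>?R\<^esub>"
    unfolding K_def by (rule eq_if_diff_zero) (simp_all add: M N)
  then show ?thesis
    using M N MN by (auto simp: Units_def)
qed

section \<open>Central elements of the Terwilliger algebra\<close>

text \<open>A nonzero submodule of least dimension works: a nonzero submodule inside it has the same
  dimension and hence equals it.\<close>

lemma exists_irreducible_T_submodule:
  fixes K :: "'a cvec set"
  assumes fin: "finite (UNIV :: 'a set)" and K: "T_module X T K" "K \<noteq> {0}"
  shows "\<exists>W \<subseteq> K. irreducible_T_module X T W"
proof -
  obtain B :: "'a cvec set" where "finite_dimensional_vector_space cscale B"
    using finite_dimensional_cscale[OF fin] by blast
  then interpret fd: finite_dimensional_vector_space "cscale :: complex \<Rightarrow> 'a cvec \<Rightarrow> _" B .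
  define P where "P W \<longleftrightarrow> T_module X T W \<and> W \<noteq> {0} \<and> W \<subseteq> K" for W
  have "P K" using K by (simp add: P_def)
  then obtain W where W: "P W" and least: "\<And>W'. P W' \<Longrightarrow> fd.dim W \<le> fd.dim W'"
    using ex_has_least_nat[of P K fd.dim] by blast
  have "W' = W" if "T_module X T W'" "W' \<subseteq> W" "W' \<noteq> {0}" for W'
  proof (rule fd.subspace_dim_equal)
    have "P W'" using that W by (auto simp: P_def)
    then show "fd.dim W \<le> fd.dim W'" by (rule least)
  qed (use that W in \<open>auto simp: P_def T_module_def\<close>)
  then show ?thesis
    using W unfolding irreducible_T_module_def P_def by blast
qed

text \<open>The kernel of a central element is a \<open>T\<close>-module. If it were nonzero, then it would contain
  an irreducible \<open>T\<close>-module, on which the element acts as a nonzero scalar.\<close>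

lemma central_acting_Units:
  fixes Z :: "'a cmat"
  assumes fin: "finite (UNIV :: 'a set)" and T: "T \<subseteq> carrier (mat_alg X)" and q: "q \<noteq> 0"
    and Z: "central_acting X T q f Z"
  shows "Z \<in> Units (mat_alg X)"
proof (rule mat_alg_Units_if_kernel_trivial[OF fin])
  show "Z \<in> carrier (mat_alg X)" using Z T by (auto simp: central_acting_def)
  interpret vector_space "cscale :: complex \<Rightarrow> 'a cvec \<Rightarrow> _" by (rule vector_space_cscale)
  define K where "K = {v \<in> vecs X. mat_vec X Z v = 0}"
  have "T_module X T K"
    unfolding T_module_def
  proof (intro conjI ballI)
    show "K \<subseteq> vecs X" by (auto simp: K_def)
    show "subspace K"
      by (rule subspaceI)
        (auto simp: K_def vecs_def mat_vec_add mat_vec_cscale mat_vec_zero, simp_all add: cscale_def)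
    fix M w assume M: "M \<in> T" and w: "w \<in> K"
    have "mat_vec X Z (mat_vec X M w) = mat_vec X M (mat_vec X Z w)"
      using Z M by (simp add: central_acting_def flip: mat_vec_mult)
    then show "mat_vec X M w \<in> K"
      using w M T mat_vec_in_vecs[of M X w] by (auto simp: K_def mat_vec_zero)
  qed
  then have *: "\<exists>W \<subseteq> K. irreducible_T_module X T W" if "K \<noteq> {0}"
    using exists_irreducible_T_submodule[OF fin] that by blast
  have "K = {0}"
  proof (rule ccontr)
    assume "K \<noteq> {0}"
    then obtain W where W: "W \<subseteq> K" "irreducible_T_module X T W"
      using * by blast
    have "0 \<in> W"
      using W(2) subspace_0 by (auto simp: irreducible_T_module_def T_module_def)
    then obtain w where w: "w \<in> W" "w \<noteq> 0"
      using W(2) by (auto simp: irreducible_T_module_def)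
    \<comment> \<open>\<open>W\<close> belongs to the family of the value \<open>f W\<close>, so the
      defining property of \<open>Z\<close> applies to \<open>w\<close> with that exponent.\<close>
    have "w \<in> span (\<Union>{W'. irreducible_T_module X T W' \<and> f W' = f W})"
      using W(2) w(1) by (intro span_base) auto
    then have "mat_vec X Z w = cscale (of_real (q powi f W)) w"
      using Z unfolding central_acting_def by blast
    moreover have "mat_vec X Z w = 0"
      using W(1) w(1) by (auto simp: K_def)
    ultimately show False
      using w(2) q by (auto simp: cscale_def fun_eq_iff)
  qed
  then show "v = 0" if "v \<in> vecs X" "mat_vec X Z v = 0" for v
    using that by (auto simp: K_def)
qed

section \<open>Containment in the matrix algebra and finiteness of the ambient space\<close>

lemma generated_algebra_subset_carrier:
  assumes "finite X" "G \<subseteq> carrier (mat_alg X)"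
  shows "generated_algebra X G \<subseteq> carrier (mat_alg X)"
proof
  interpret complex_algebra "mat_alg X" by (rule complex_algebra_mat_alg[OF assms(1)])
  fix M assume "M \<in> generated_algebra X G"
  then show "M \<in> carrier (mat_alg X)"
    by induction (use assms(2) in auto)
qed

lemma terwilliger_algebra_subset_carrier:
  assumes "finite X" "A \<in> carrier (mat_alg X)"
  shows "terwilliger_algebra X A x \<subseteq> carrier (mat_alg X)"
  unfolding terwilliger_algebra_def
  using assms by (intro generated_algebra_subset_carrier)
    (auto simp: dual_adjacency_def diag_def mat_alg_simps)

lemma finite_UNIV_of_finite_span:
  fixes scale :: "'k::{field,finite} \<Rightarrow> 'u::ab_group_add \<Rightarrow> 'u"
  assumes "vector_space scale" "finite B" "module.span scale B = UNIV"
  shows "finite (UNIV :: 'u set)"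
proof -
  interpret vector_space scale by fact
  let ?c = "\<lambda>f. \<Sum>v\<in>B. scale (f v) v"
  have "UNIV \<subseteq> ?c ` (B \<rightarrow>\<^sub>E UNIV)"
  proof
    fix w
    have "w \<in> range ?c"
      using span_finite[OF assms(2)] assms(3) by simp
    then obtain f where "w = ?c f" by blast
    \<comment> \<open>Restriction to \<open>B\<close> makes the coefficient function extensional,
      hence a member of a finite function set.\<close>
    then have "w = ?c (restrict f B)" by simp
    then show "w \<in> ?c ` (B \<rightarrow>\<^sub>E UNIV)"
      by (rule image_eqI[where x = "restrict f B"]) simp
  qed
  moreover have "finite (?c ` (B \<rightarrow>\<^sub>E UNIV))"
    by (intro finite_imageI finite_PiE assms(2)) simp
  ultimately show ?thesis
    by (rule finite_subset)
qed

section \<open>Representations of the quantum algebra\<close>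

lemma ring_free_ring: "ring free_ring"
proof -
  have "\<exists>b. b + a = 0 \<and> a + b = 0" for a :: uq_free
    by (rule exI[of _ "- a"]) simp
  then show ?thesis
    by unfold_locales (auto simp: free_ring_def Units_def algebra_simps)
qed

lemma free_scalar_uminus: "free_scalar (- c) = - free_scalar c"
  by (simp add: free_scalar_def single_uminus)

lemma free_scalar_one: "free_scalar 1 = 1"
  by (simp add: free_scalar_def)

text \<open>The condition on \<open>q\<close> makes the factor \<open>1 / (q - inverse q)\<close> in
  the relators a true inverse; otherwise it would be 0 by convention.\<close>

locale uq_rep =
  fixes q :: complex and X :: "'a set" and \<pi> :: "uq_free set \<Rightarrow> 'a cmat"
  assumes finite_X: "finite X" and rep: "uq_representation q X \<pi>" and q_diff: "q - inverse q \<noteq> 0"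
begin

sublocale complex_algebra "mat_alg X"
  by (rule complex_algebra_mat_alg[OF finite_X])

text \<open>The pullback of \<open>\<pi>\<close> to the free algebra, where the relators are
  concrete elements.\<close>

definition \<phi> :: "uq_free \<Rightarrow> 'a cmat" where "\<phi> a = \<pi> (uq_class q a)"

lemma uq_ideal: "ideal (uq_ideal q) free_ring"
  unfolding uq_ideal_def
  by (rule ring.genideal_ideal[OF ring_free_ring]) (simp add: free_ring_def)

lemma phi_hom: "\<phi> \<in> ring_hom free_ring (mat_alg X)"
proof -
  have "uq_class q \<in> ring_hom free_ring (Uq q)"
    using ideal.rcos_ring_hom[OF uq_ideal] by (simp add: uq_class_def[abs_def] Uq_def)
  moreover have "\<pi> \<in> ring_hom (Uq q) (mat_alg X)"
    using rep by (simp add: uq_representation_def)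
  ultimately show ?thesis
    using ring_hom_trans[of "uq_class q" free_ring "Uq q" \<pi>] by (simp add: \<phi>_def[abs_def] comp_def)
qed

lemma phi_closed [simp]: "\<phi> a \<in> carrier (mat_alg X)"
  using ring_hom_closed[OF phi_hom, of a] by (simp add: free_ring_def)

lemma phi_add: "\<phi> (a + b) = \<phi> a \<oplus>\<^bsub>mat_alg X\<^esub> \<phi> b"
  using ring_hom_add[OF phi_hom, of a b] by (simp add: free_ring_def)

lemma phi_mult: "\<phi> (a * b) = \<phi> a \<otimes>\<^bsub>mat_alg X\<^esub> \<phi> b"
  using ring_hom_mult[OF phi_hom, of a b] by (simp add: free_ring_def)

lemma phi_scalar: "\<phi> (free_scalar c) = c \<odot>\<^bsub>mat_alg X\<^esub> \<one>\<^bsub>mat_alg X\<^esub>"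
  using rep by (simp add: uq_representation_def \<phi>_def)

lemma phi_relator:
  assumes "r \<in> uq_relators q"
  shows "\<phi> r = \<zero>\<^bsub>mat_alg X\<^esub>"
proof -
  interpret I: ideal "uq_ideal q" free_ring by (rule uq_ideal)
  have "r \<in> uq_ideal q"
    using ring.genideal_self[OF ring_free_ring, of "uq_relators q"] assms
    by (auto simp: uq_ideal_def free_ring_def)
  then have "uq_class q r = uq_class q \<zero>\<^bsub>free_ring\<^esub>"
    unfolding uq_class_def by (simp add: I.a_rcos_const)
  then show ?thesis
    using ring_hom_zero[OF phi_hom ring_free_ring ring_axioms] by (simp add: \<phi>_def)
qed

lemma phi_weyl:
  assumes "q_weyl_relator q u v \<in> uq_relators q"
  shows "q \<odot>\<^bsub>mat_alg X\<^esub> (\<phi> u \<otimes>\<^bsub>mat_alg X\<^esub> \<phi> v) \<ominus>\<^bsub>mat_alg X\<^esub>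
      inverse q \<odot>\<^bsub>mat_alg X\<^esub> (\<phi> v \<otimes>\<^bsub>mat_alg X\<^esub> \<phi> u) = (q - inverse q) \<odot>\<^bsub>mat_alg X\<^esub> \<one>\<^bsub>mat_alg X\<^esub>"
    (is "?w = _")
proof -
  let ?R = "mat_alg X" and ?k = "1 / (q - inverse q)"
  have w: "?w \<in> carrier ?R" by simp
  \<comment> \<open>Differences are rewritten as sums with negated scalars, to match the rules for
    \<open>\<phi>\<close> on sums, products and scalars.\<close>
  have "q_weyl_relator q u v = free_scalar ?k *
      (free_scalar q * u * v + free_scalar (- inverse q) * v * u) + free_scalar (- 1)"
    by (simp add: q_weyl_relator_def free_scalar_uminus free_scalar_one)
  then have "?k \<odot>\<^bsub>?R\<^esub> ?w \<oplus>\<^bsub>?R\<^esub> (- 1) \<odot>\<^bsub>?R\<^esub> \<one>\<^bsub>?R\<^esub> = \<zero>\<^bsub>?R\<^esub>"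
    using phi_relator[OF assms]
    by (simp add: phi_add phi_mult phi_scalar smult_mult_left minus_eq smult_minus l_minus)
  then have "?k \<odot>\<^bsub>?R\<^esub> ?w \<ominus>\<^bsub>?R\<^esub> \<one>\<^bsub>?R\<^esub> = \<zero>\<^bsub>?R\<^esub>"
    by (simp add: smult_minus minus_eq)
  then have "?k \<odot>\<^bsub>?R\<^esub> ?w = \<one>\<^bsub>?R\<^esub>"
    by (rule eq_if_diff_zero) simp_all
  then have "(q - inverse q) \<odot>\<^bsub>?R\<^esub> (?k \<odot>\<^bsub>?R\<^esub> ?w) = (q - inverse q) \<odot>\<^bsub>?R\<^esub> \<one>\<^bsub>?R\<^esub>"
    by simp
  then show ?thesis
    using w q_diff smult_smult[OF w, of "q - inverse q" ?k] by simp
qed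

lemma generators_closed [simp]:
  "\<pi> (uq_x q) \<in> carrier (mat_alg X)" "\<pi> (uq_y q) \<in> carrier (mat_alg X)" "\<pi> (uq_z q) \<in> carrier (mat_alg X)"
  using phi_closed by (simp_all add: uq_x_def uq_y_def uq_z_def \<phi>_def)

lemma z_Units: "\<pi> (uq_z q) \<in> Units (mat_alg X)"
proof -
  let ?R = "mat_alg X"
  have "\<phi> u \<otimes>\<^bsub>?R\<^esub> \<phi> v = \<one>\<^bsub>?R\<^esub>" if "u * v - 1 \<in> uq_relators q" for u v
  proof -
    have "\<phi> (u * v) = \<phi> ((u * v - 1) + 1)" by simp
    also have "\<dots> = \<phi> (free_scalar 1)"
      by (simp only: phi_add phi_relator[OF that]) (simp add: free_scalar_one)
    finally show ?thesis by (simp add: phi_mult phi_scalar)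
  qed
  then have "\<phi> (free_gen Gen_z) \<otimes>\<^bsub>?R\<^esub> \<phi> (free_gen Gen_zinv) = \<one>\<^bsub>?R\<^esub>"
    "\<phi> (free_gen Gen_zinv) \<otimes>\<^bsub>?R\<^esub> \<phi> (free_gen Gen_z) = \<one>\<^bsub>?R\<^esub>"
    by (simp_all add: uq_relators_def)
  then have "\<phi> (free_gen Gen_z) \<in> Units ?R"
    unfolding Units_def using phi_closed by blast
  then show ?thesis by (simp add: \<phi>_def uq_z_def)
qed

lemma yz_relation:
  "q \<odot>\<^bsub>mat_alg X\<^esub> (\<pi> (uq_y q) \<otimes>\<^bsub>mat_alg X\<^esub> \<pi> (uq_z q)) \<ominus>\<^bsub>mat_alg X\<^esub>
    inverse q \<odot>\<^bsub>mat_alg X\<^esub> (\<pi> (uq_z q) \<otimes>\<^bsub>mat_alg X\<^esub> \<pi> (uq_y q)) = (q - inverse q) \<odot>\<^bsub>mat_alg X\<^esub> \<one>\<^bsub>mat_alg X\<^esub>"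
  using phi_weyl[of "free_gen Gen_y" "free_gen Gen_z"]
  by (simp add: uq_relators_def uq_y_def uq_z_def \<phi>_def)

lemma zx_relation:
  "q \<odot>\<^bsub>mat_alg X\<^esub> (\<pi> (uq_z q) \<otimes>\<^bsub>mat_alg X\<^esub> \<pi> (uq_x q)) \<ominus>\<^bsub>mat_alg X\<^esub>
    inverse q \<odot>\<^bsub>mat_alg X\<^esub> (\<pi> (uq_x q) \<otimes>\<^bsub>mat_alg X\<^esub> \<pi> (uq_z q)) = (q - inverse q) \<odot>\<^bsub>mat_alg X\<^esub> \<one>\<^bsub>mat_alg X\<^esub>"
  using phi_weyl[of "free_gen Gen_z" "free_gen Gen_x"]
  by (simp add: uq_relators_def uq_x_def uq_z_def \<phi>_def)

end

section \<open>Application to the two module structures on a dual polar graph\<close>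

theorem theorem24p13:
  fixes scale :: "'k::{field,finite} \<Rightarrow> 'u::ab_group_add \<Rightarrow> 'u"
    and F :: "('k, 'u) polar_form"
    and D :: nat and e b q :: real and Q :: complex
    and X :: "'u set set" and x :: "'u set"
    and A Astar \<Upsilon> \<Psi> :: "'u set cmat"
    and R (structure)
    and \<pi>1 \<pi>2 :: "uq_free set \<Rightarrow> 'u set cmat"
  assumes "D \<ge> 3" and "polar_space scale F D e"
    and "b = real (card (UNIV :: 'k set))" and "q = sqrt b" and "Q = complex_of_real q"
    and "X = dp_vertices scale F" and "x \<in> X"
    and "A = dp_adjacency scale F D" and "Astar = dual_adjacency X A x"
    and "R = mat_alg X"
    and "is_Upsilon X A (dp_dist scale D) D x q \<Upsilon>"
    and "is_Psi X A (dp_dist scale D) D x q \<Psi>"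
    and "first_module_structure b q D e X A Astar \<Upsilon> \<Psi> \<pi>1"
    and "second_module_structure b q D e X A Astar \<Upsilon> \<Psi> \<pi>2"
  shows "\<pi>2 (uq_z Q) = \<pi>1 (uq_z Q) \<and>
    \<pi>2 (uq_x Q) =
      (- of_real (q powr (2 * e))) \<odot> (\<Upsilon> [^] (-2::int) \<otimes> \<Psi> [^] (2::int) \<otimes> \<pi>1 (uq_x Q))
      \<oplus> (\<one> \<oplus> of_real (q powr (2 * e)) \<odot> (\<Upsilon> [^] (-2::int) \<otimes> \<Psi> [^] (2::int))) \<otimes> inv (\<pi>1 (uq_z Q)) \<and>
    \<pi>2 (uq_y Q) =
      (- of_real (q powr (- 2 * e))) \<odot> (\<Upsilon> [^] (2::int) \<otimes> \<Psi> [^] (-2::int) \<otimes> \<pi>1 (uq_y Q))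
      \<oplus> (\<one> \<oplus> of_real (q powr (- 2 * e)) \<odot> (\<Upsilon> [^] (2::int) \<otimes> \<Psi> [^] (-2::int))) \<otimes> inv (\<pi>1 (uq_z Q))"
proof -
  have "vector_space scale" and "\<exists>B. finite B \<and> module.span scale B = UNIV"
    using assms(2) by (simp_all add: polar_space_def)
  then have "finite (UNIV :: 'u set)"
    using finite_UNIV_of_finite_span by blast
  then have fin: "finite (UNIV :: 'u set set)"
    by (simp add: Finite_Set.finite_set)
  then have finX: "finite X" by (rule rev_finite_subset) simp
  have "card {0, 1 :: 'k} \<le> card (UNIV :: 'k set)"
    by (intro card_mono) auto
  then have b: "b > 1" using assms(3) by simp
  then have q: "q > 1" using assms(4) by simp
  \<comment> \<open>A real number above 1 is not a root of unity. Exponent 4 separates the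
    conjugation eigenvalues, and exponent 2 gives \<open>Q - inverse Q \<noteq> 0\<close>.\<close>
  have Q: "Q \<noteq> 0" "Q ^ 4 \<noteq> 1" "Q - inverse Q \<noteq> 0"
  proof -
    have "q ^ n \<noteq> 1" if "n > 0" for n
      using one_less_power[OF q that] by simp
    then have "Q ^ n \<noteq> 1" if "n > 0" for n
      using that assms(5) by (metis of_real_eq_1_iff of_real_power)
    from this[of 4] this[of 2] show "Q ^ 4 \<noteq> 1" "Q - inverse Q \<noteq> 0"
      using q assms(5) by (auto simp: field_simps power2_eq_square)
    show "Q \<noteq> 0" using q assms(5) by simp
  qed
  interpret rep1: uq_rep Q X \<pi>1
    using finX Q assms(5,13) by unfold_locales (simp_all add: first_module_structure_def Let_def)
  interpret rep2: uq_rep Q X \<pi>2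
    using finX Q assms(5,14) by unfold_locales (simp_all add: second_module_structure_def Let_def)
  let ?T = "terwilliger_algebra X A x"
  have T: "?T \<subseteq> carrier (mat_alg X)"
    by (intro terwilliger_algebra_subset_carrier finX)
      (simp add: mat_alg_simps assms(6,8) dp_adjacency_def)
  have units: "\<Upsilon> \<in> Units (mat_alg X)" "\<Psi> \<in> Units (mat_alg X)"
    using assms(11,12) central_acting_Units[OF fin T, of q] q
    by (auto simp: is_Upsilon_def is_Psi_def)
  have mem: "\<Upsilon> \<in> ?T" "\<Psi> \<in> ?T"
    using assms(11,12) by (simp_all add: is_Upsilon_def is_Psi_def central_acting_def)
  have central: "\<Upsilon> \<otimes>\<^bsub>mat_alg X\<^esub> M = M \<otimes>\<^bsub>mat_alg X\<^esub> \<Upsilon>" "\<Psi> \<otimes>\<^bsub>mat_alg X\<^esub> M = M \<otimes>\<^bsub>mat_alg X\<^esub> \<Psi>"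
    if "M \<in> ?T" for M
    using assms(11,12) that unfolding is_Upsilon_def is_Psi_def central_acting_def by blast+
  have "Astar \<in> ?T"
    by (simp add: assms(9) terwilliger_algebra_def generated_algebra.gen)
  note comm = central(1)[OF mem(2)] central[OF this]
  have q2: "q\<^sup>2 - 1 \<noteq> 0" using one_less_power[OF q, of 2] by simp
  have pos: "c_kappa q D e \<noteq> 0" "c_upsilon q D \<noteq> 0" "c_kappastar b q D e \<noteq> 0"
  proof -
    show "c_kappa q D e \<noteq> 0" "c_upsilon q D \<noteq> 0"
      using q q2 by (simp_all add: c_kappa_def c_upsilon_def)
    \<comment> \<open>These cover every factor of \<open>c_xi\<close> other than \<open>b\<close>
      and \<open>b - 1\<close>, whatever the sign of the exponents.\<close>
    have "b powr r + 1 > 0" "b powr r + b > 0" for r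
      using b powr_ge_zero[of b r] by linarith+
    then show "c_kappastar b q D e \<noteq> 0"
      using b q by (simp add: c_kappastar_def c_xi_def less_imp_neq[symmetric])
  qed
  \<comment> \<open>The common factor \<open>q ^ D / (q\<^sup>2 - 1)\<close> cancels; this ratio is
    the source of the power \<open>q powr (2 * e)\<close> in the result.\<close>
  have "c_kappa q D e / c_upsilon q D = - (q powr (2 * e))"
    using q q2 by (simp add: c_kappa_def c_upsilon_def powr_add powr_realpow)
  then have g: "complex_of_real (c_kappa q D e) / of_real (c_upsilon q D) = - of_real (q powr (2 * e))"
    by (simp flip: of_real_divide)
  have ginv: "inverse (complex_of_real (q powr (2 * e))) = of_real (q powr (- 2 * e))"
    by (simp add: powr_minus)
  note eqs = assms(13)[unfolded first_module_structure_def Let_def, folded assms(5)]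
    assms(14)[unfolded second_module_structure_def Let_def, folded assms(5)]
  have nz: "complex_of_real (c_kappa q D e) \<noteq> 0" "complex_of_real (c_upsilon q D) \<noteq> 0"
    "complex_of_real (c_kappastar b q D e) \<noteq> 0"
    using pos by simp_all
  note main = rep1.equitable_triples_related[OF units comm(1) rep1.z_Units rep2.generators_closed(3)
      rep1.generators_closed(1,2) rep2.generators_closed(1,2) Q(1,2) nz
      rep1.zx_relation rep1.yz_relation rep2.zx_relation rep2.yz_relation
      eqs(1)[THEN conjunct2, THEN conjunct1] eqs(2)[THEN conjunct2, THEN conjunct1]
      eqs(1)[THEN conjunct2, THEN conjunct2] eqs(2)[THEN conjunct2, THEN conjunct2]
      comm(2,3) g]
  show ?thesis
    unfolding assms(10) using main unfolding ginv by (intro conjI)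
qed

end
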